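(* Let $\mathcal L_1$ and $\mathcal L_2$ be atomistic lattices. Then $\mathcal L_1\,\underline{\otimes}_n\,\mathcal L_2\cong\mathcal L_1\square\mathcal L_2$ (isomorphism of lattices).
   Context: An atomistic lattice is a lattice with $0$ in which every element is the join of the atoms below it. For lattices $\mathcal L_1,\mathcal L_2$ and $(a,b)\in\mathcal L_1\times\mathcal L_2$, let $a\downarrow=\{x: x\le a\}$ and $a\square b=(a\downarrow\times\mathcal L_2)\cup(\mathcal L_1\times b\downarrow)$. The box product $\mathcal L_1\square\mathcal L_2$ is the set of all (nonempty) finite intersections of sets $a_i\square b_i$, $(a_i,b_i)\in\mathcal L_1\times\mathcal L_2$, ordered by set-inclusion. For an atomistic lattice $\mathcal L_i$, let $\Sigma_i$ be its set of atoms, and for $a\in\mathcal L_i$ let $\Sigma[a]\subseteq\Sigma_i$ be the set of atoms $\le a$. Then $\mathcal L_1\,\underline{\otimes}_n\,\mathcal L_2$ is the set of all (nonempty) finite intersections of sets of the form $(\Sigma[a_1]\times\Sigma_2)\cup(\Sigma_1\times\Sigma[a_2])$ with $a_i\in\mathcal L_i$, ordered by set-inclusion. *)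

theory Defs
  imports "HOL-Algebra.Lattice"
begin

definition atoms :: "('a, 'm) gorder_scheme \<Rightarrow> 'a set"
  where "atoms L = {p \<in> carrier L. p \<noteq> \<bottom>\<^bsub>L\<^esub> \<and>
    (\<forall>x\<in>carrier L. x \<sqsubseteq>\<^bsub>L\<^esub> p \<longrightarrow> x = \<bottom>\<^bsub>L\<^esub> \<or> x = p)}"

definition atoms_below :: "('a, 'm) gorder_scheme \<Rightarrow> 'a \<Rightarrow> 'a set"
  where "atoms_below L a = {p \<in> atoms L. p \<sqsubseteq>\<^bsub>L\<^esub> a}"

text \<open>
  The lattice need not be complete and need not have a greatest element, so that an element is the
  join of the atoms below it is expressed by \<^const>\<open>is_lub\<close>, which includes the existence of that
  join. An equation with \<^const>\<open>sup\<close>, which is a choice operator, would not.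
\<close>

locale atomistic_lattice = lattice + weak_partial_order_bottom +
  assumes is_lub_atoms_below: "x \<in> carrier L \<Longrightarrow> is_lub L x (atoms_below L x)"

definition finite_Inters :: "'a set set \<Rightarrow> 'a set set"
  where "finite_Inters B = {\<Inter>F |F. finite F \<and> F \<noteq> {} \<and> F \<subseteq> B}"

definition inclusion_order :: "'a set set \<Rightarrow> 'a set gorder"
  where "inclusion_order S = \<lparr>carrier = S, eq = (=), le = (\<subseteq>)\<rparr>"

definition down :: "('a, 'm) gorder_scheme \<Rightarrow> 'a \<Rightarrow> 'a set"
  where "down L a = {x \<in> carrier L. x \<sqsubseteq>\<^bsub>L\<^esub> a}"

definition box :: "('a, 'm) gorder_scheme \<Rightarrow> ('b, 'n) gorder_scheme \<Rightarrow> 'a \<Rightarrow> 'b \<Rightarrow> ('a \<times> 'b) set"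
  where "box L1 L2 a b = down L1 a \<times> carrier L2 \<union> carrier L1 \<times> down L2 b"

definition box_product ::
    "('a, 'm) gorder_scheme \<Rightarrow> ('b, 'n) gorder_scheme \<Rightarrow> ('a \<times> 'b) set gorder"
  where "box_product L1 L2 =
    inclusion_order (finite_Inters {box L1 L2 a b |a b. a \<in> carrier L1 \<and> b \<in> carrier L2})"

definition atom_box ::
    "('a, 'm) gorder_scheme \<Rightarrow> ('b, 'n) gorder_scheme \<Rightarrow> 'a \<Rightarrow> 'b \<Rightarrow> ('a \<times> 'b) set"
  where "atom_box L1 L2 a b = atoms_below L1 a \<times> atoms L2 \<union> atoms L1 \<times> atoms_below L2 b"

definition tensor_n ::
    "('a, 'm) gorder_scheme \<Rightarrow> ('b, 'n) gorder_scheme \<Rightarrow> ('a \<times> 'b) set gorder"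
  where "tensor_n L1 L2 =
    inclusion_order (finite_Inters {atom_box L1 L2 a b |a b. a \<in> carrier L1 \<and> b \<in> carrier L2})"

text \<open>
  Both \<^const>\<open>join_pres\<close> and \<^const>\<open>meet_pres\<close> include that the two orders are lattices.
\<close>

definition lattice_isomorphic :: "('a, 'm) gorder_scheme \<Rightarrow> ('b, 'n) gorder_scheme \<Rightarrow> bool"
  where "lattice_isomorphic X Y \<longleftrightarrow>
    (\<exists>f. bij_betw f (carrier X) (carrier Y) \<and> join_pres X Y f \<and> meet_pres X Y f)"

end

theory Submission
  imports Defs
begin

text \<open>
  An element \<open>x\<close> of an atomistic lattice lies below \<open>a\<close> if and only if every atom below \<open>x\<close> does.
  Hence a point \<open>(x, y)\<close> lies in the box of \<open>(a, b)\<close> if and only if all pairs of atoms below \<open>x\<close> and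
  \<open>y\<close> lie in the atom box of \<open>(a, b)\<close>: if neither \<open>x\<close> is below \<open>a\<close> nor \<open>y\<close> below \<open>b\<close>, an atom
  witnessing the first and an atom witnessing the second form a pair outside the atom box.
  The operator \<open>saturate\<close>, which sends a set \<open>H\<close> of pairs of atoms to the set of all \<open>(x, y)\<close> whose
  pairs of atoms lie in \<open>H\<close>, thus turns atom boxes into boxes. It commutes with intersections, and
  \<open>H\<close> is recovered as the set of pairs of atoms in its image, so that it is an order isomorphism
  from the tensor product onto the box product (\<open>bij_betw_saturate\<close>, \<open>saturate_subset_iff\<close>).

  An order isomorphism onto a lattice is a lattice isomorphism, and its domain is then a lattice as
  well (\<open>lattice_isomorphic_if_order_iso\<close>). It remains to see that the box product is a lattice.
  Meets are intersections. For joins, infinitely many boxes may contain two given elements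
  \<open>A\<close> and \<open>B\<close>, but finitely many of them suffice: there is a finite family of boxes such that
  every box containing \<open>A \<union> B\<close> contains a member of the family. The intersection of this family is
  the join. The finite family comes from writing an element of the box product, by distributivity,
  as a finite union of rectangles (\<open>box_generated_Times_Inter\<close>) and from the closure of the finiteness
  property under unions (\<open>box_generated_Un\<close>).
\<close>

section \<open>Order isomorphisms onto lattices\<close>

lemma is_lub_pair_iff:
  assumes "x \<in> carrier L" "y \<in> carrier L"
  shows "is_lub L s {x, y} \<longleftrightarrow> s \<in> carrier L \<and> x \<sqsubseteq>\<^bsub>L\<^esub> s \<and> y \<sqsubseteq>\<^bsub>L\<^esub> s \<and>
    (\<forall>u\<in>carrier L. x \<sqsubseteq>\<^bsub>L\<^esub> u \<and> y \<sqsubseteq>\<^bsub>L\<^esub> u \<longrightarrow> s \<sqsubseteq>\<^bsub>L\<^esub> u)"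
  using assms unfolding least_def Upper_def by blast

lemma is_glb_pair_iff:
  assumes "x \<in> carrier L" "y \<in> carrier L"
  shows "is_glb L s {x, y} \<longleftrightarrow> s \<in> carrier L \<and> s \<sqsubseteq>\<^bsub>L\<^esub> x \<and> s \<sqsubseteq>\<^bsub>L\<^esub> y \<and>
    (\<forall>u\<in>carrier L. u \<sqsubseteq>\<^bsub>L\<^esub> x \<and> u \<sqsubseteq>\<^bsub>L\<^esub> y \<longrightarrow> u \<sqsubseteq>\<^bsub>L\<^esub> s)"
  using assms unfolding greatest_def Lower_def by blast

lemma is_lub_order_iso_iff:
  assumes emb: "order_emb X Y f" and bij: "bij_betw f (carrier X) (carrier Y)"
    and "x \<in> carrier X" "y \<in> carrier X" "s \<in> carrier X"
  shows "is_lub X s {x, y} \<longleftrightarrow> is_lub Y (f s) {f x, f y}"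
proof -
  have "\<And>u v. u \<in> carrier X \<Longrightarrow> v \<in> carrier X \<Longrightarrow> f u \<sqsubseteq>\<^bsub>Y\<^esub> f v \<longleftrightarrow> u \<sqsubseteq>\<^bsub>X\<^esub> v"
    using emb by (auto simp: order_emb_def)
  moreover have "carrier Y = f ` carrier X"
    using bij by (simp add: bij_betw_def)
  ultimately show ?thesis
    using assms(3-5) by (simp add: is_lub_pair_iff)
qed

lemma is_glb_order_iso_iff:
  assumes emb: "order_emb X Y f" and bij: "bij_betw f (carrier X) (carrier Y)"
    and "x \<in> carrier X" "y \<in> carrier X" "s \<in> carrier X"
  shows "is_glb X s {x, y} \<longleftrightarrow> is_glb Y (f s) {f x, f y}"
proof -
  have "\<And>u v. u \<in> carrier X \<Longrightarrow> v \<in> carrier X \<Longrightarrow> f u \<sqsubseteq>\<^bsub>Y\<^esub> f v \<longleftrightarrow> u \<sqsubseteq>\<^bsub>X\<^esub> v"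
    using emb by (auto simp: order_emb_def)
  moreover have "carrier Y = f ` carrier X"
    using bij by (simp add: bij_betw_def)
  ultimately show ?thesis
    using assms(3-5) by (simp add: is_glb_pair_iff)
qed

lemma lattice_isomorphic_if_order_iso:
  assumes X: "partial_order X" and Y: "lattice Y"
    and emb: "order_emb X Y f" and bij: "bij_betw f (carrier X) (carrier Y)"
  shows "lattice_isomorphic X Y"
proof -
  interpret X: partial_order X by (rule X)
  interpret Y: lattice Y by (rule Y)
  have image: "f ` carrier X = carrier Y"
    using bij by (rule bij_betw_imp_surj_on)
  have "lattice X"
  proof
    fix x y assume xy: "x \<in> carrier X" "y \<in> carrier X"
    then have fxy: "f x \<in> carrier Y" "f y \<in> carrier Y" using image by auto
    from Y.sup_of_two_exists[OF fxy] obtain s where "is_lub Y s {f x, f y}" ..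
    moreover from this obtain t where "t \<in> carrier X" "s = f t"
      using image by (blast dest: least_closed)
    ultimately show "\<exists>s. is_lub X s {x, y}"
      using is_lub_order_iso_iff[OF emb bij xy] by blast
    from Y.inf_of_two_exists[OF fxy] obtain s where "is_glb Y s {f x, f y}" ..
    moreover from this obtain t where "t \<in> carrier X" "s = f t"
      using image by (blast dest: greatest_closed)
    ultimately show "\<exists>s. is_glb X s {x, y}"
      using is_glb_order_iso_iff[OF emb bij xy] by blast
  qed
  then interpret X: lattice X .
  have "f (x \<squnion>\<^bsub>X\<^esub> y) = f x \<squnion>\<^bsub>Y\<^esub> f y" "f (x \<sqinter>\<^bsub>X\<^esub> y) = f x \<sqinter>\<^bsub>Y\<^esub> f y"
    if xy: "x \<in> carrier X" "y \<in> carrier X" for x y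
  proof -
    have fxy: "f x \<in> carrier Y" "f y \<in> carrier Y" using image xy by auto
    have "is_lub X (x \<squnion>\<^bsub>X\<^esub> y) {x, y}"
      using X.sup_of_two_least[OF xy] by (simp add: join_def)
    then have "is_lub Y (f (x \<squnion>\<^bsub>X\<^esub> y)) {f x, f y}"
      using is_lub_order_iso_iff[OF emb bij xy, of "x \<squnion>\<^bsub>X\<^esub> y"] xy by simp
    moreover have "is_lub Y (f x \<squnion>\<^bsub>Y\<^esub> f y) {f x, f y}"
      using Y.sup_of_two_least[OF fxy] by (simp add: join_def)
    ultimately show "f (x \<squnion>\<^bsub>X\<^esub> y) = f x \<squnion>\<^bsub>Y\<^esub> f y"
      by (rule Y.least_unique)
    have "is_glb X (x \<sqinter>\<^bsub>X\<^esub> y) {x, y}"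
      using X.inf_of_two_greatest[OF xy] by (simp add: meet_def)
    then have "is_glb Y (f (x \<sqinter>\<^bsub>X\<^esub> y)) {f x, f y}"
      using is_glb_order_iso_iff[OF emb bij xy, of "x \<sqinter>\<^bsub>X\<^esub> y"] xy by simp
    moreover have "is_glb Y (f x \<sqinter>\<^bsub>Y\<^esub> f y) {f x, f y}"
      using Y.inf_of_two_greatest[OF fxy] by (simp add: meet_def)
    ultimately show "f (x \<sqinter>\<^bsub>X\<^esub> y) = f x \<sqinter>\<^bsub>Y\<^esub> f y"
      by (rule Y.greatest_unique)
  qed
  with bij \<open>lattice X\<close> Y show ?thesis
    unfolding lattice_isomorphic_def join_pres_def meet_pres_def by blast
qed

section \<open>Finite intersections ordered by inclusion\<close>

lemma partial_order_inclusion_order: "partial_order (inclusion_order S)"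
  by unfold_locales (auto simp: inclusion_order_def)

lemma finite_Inters_Int:
  assumes "A \<in> finite_Inters B" "A' \<in> finite_Inters B"
  shows "A \<inter> A' \<in> finite_Inters B"
proof -
  from assms obtain F F' where "finite F" "F \<noteq> {}" "F \<subseteq> B" "A = \<Inter>F"
    and "finite F'" "F' \<subseteq> B" "A' = \<Inter>F'"
    unfolding finite_Inters_def by blast
  then have "A \<inter> A' = \<Inter>(F \<union> F')" "finite (F \<union> F')" "F \<union> F' \<noteq> {}" "F \<union> F' \<subseteq> B" by auto
  then show ?thesis unfolding finite_Inters_def by blast
qed

text \<open>
  The family \<open>F\<close> in the assumption replaces the possibly infinite family of all generators that
  contain \<open>A\<close> and \<open>A'\<close>. Its intersection is their join: an upper bound is an intersection of such
  generators, and each of these contains a member of \<open>F\<close>.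
\<close>

lemma lattice_finite_Inters:
  assumes covers: "\<And>A A'. A \<in> finite_Inters B \<Longrightarrow> A' \<in> finite_Inters B \<Longrightarrow>
    \<exists>F. finite F \<and> F \<noteq> {} \<and> F \<subseteq> B \<and> (\<forall>C\<in>F. A \<union> A' \<subseteq> C) \<and>
      (\<forall>C\<in>B. A \<union> A' \<subseteq> C \<longrightarrow> (\<exists>D\<in>F. D \<subseteq> C))"
  shows "lattice (inclusion_order (finite_Inters B))"
proof -
  let ?L = "inclusion_order (finite_Inters B)"
  interpret partial_order ?L by (rule partial_order_inclusion_order)
  show ?thesis
  proof
    fix A A' assume "A \<in> carrier ?L" "A' \<in> carrier ?L"
    then have A: "A \<in> finite_Inters B" "A' \<in> finite_Inters B"
      by (simp_all add: inclusion_order_def)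
    then have "is_glb ?L (A \<inter> A') {A, A'}"
      using finite_Inters_Int[OF A] by (auto simp: greatest_def Lower_def inclusion_order_def)
    then show "\<exists>s. is_glb ?L s {A, A'}" ..
    from covers[OF A] obtain F where F: "finite F" "F \<noteq> {}" "F \<subseteq> B" "\<forall>C\<in>F. A \<union> A' \<subseteq> C"
      and least: "\<forall>C\<in>B. A \<union> A' \<subseteq> C \<longrightarrow> (\<exists>D\<in>F. D \<subseteq> C)" by blast
    have "\<Inter>F \<subseteq> E" if "E \<in> finite_Inters B" "A \<subseteq> E" "A' \<subseteq> E" for E
    proof -
      from that(1) obtain G where "G \<subseteq> B" "E = \<Inter>G" unfolding finite_Inters_def by blast
      have "\<Inter>F \<subseteq> C" if "C \<in> G" for C
      proof -
        have "C \<in> B" "A \<union> A' \<subseteq> C"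
          using that \<open>G \<subseteq> B\<close> \<open>A \<subseteq> E\<close> \<open>A' \<subseteq> E\<close> \<open>E = \<Inter>G\<close> by auto
        with least obtain D where "D \<in> F" "D \<subseteq> C" by blast
        then show ?thesis by blast
      qed
      then show ?thesis using \<open>E = \<Inter>G\<close> by blast
    qed
    moreover have "\<Inter>F \<in> finite_Inters B" "A \<subseteq> \<Inter>F" "A' \<subseteq> \<Inter>F"
      using F unfolding finite_Inters_def by blast+
    ultimately have "is_lub ?L (\<Inter>F) {A, A'}"
      using A by (auto simp: least_def Upper_def inclusion_order_def)
    then show "\<exists>s. is_lub ?L s {A, A'}" ..
  qed
qed

section \<open>The box product is a lattice\<close>

locale lattice_with_zero = lattice + weak_partial_order_bottom

text \<open>
  The whole carrier is admitted because a lattice without a greatest element need not have it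
  among its principal ideals.
\<close>

definition principal_or_whole :: "('a, 'm) gorder_scheme \<Rightarrow> 'a set \<Rightarrow> bool"
  where "principal_or_whole L U \<longleftrightarrow> U = carrier L \<or> (\<exists>u\<in>carrier L. U = down L u)"

lemma (in lattice) down_Int_down:
  assumes "a \<in> carrier L" "b \<in> carrier L"
  shows "down L a \<inter> down L b = down L (a \<sqinter> b)"
proof -
  have "x \<sqsubseteq> a \<sqinter> b \<longleftrightarrow> x \<sqsubseteq> a \<and> x \<sqsubseteq> b" if "x \<in> carrier L" for x
    using assms that by (meson le_trans meet_closed meet_le meet_left meet_right)
  then show ?thesis by (auto simp: down_def)
qed

lemma (in lattice) principal_or_whole_Int_down:
  assumes "principal_or_whole L U" "a \<in> carrier L"
  shows "principal_or_whole L (U \<inter> down L a)"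
proof -
  have "carrier L \<inter> down L a = down L a" by (auto simp: down_def)
  moreover have "down L u \<inter> down L a = down L (u \<sqinter> a)" if "u \<in> carrier L" for u
    using that assms(2) by (rule down_Int_down)
  ultimately show ?thesis
    using assms unfolding principal_or_whole_def by (metis meet_closed)
qed

text \<open>
  For a principal ideal, \<open>M\<close> is a singleton. For the whole carrier it consists of the greatest
  element, or is empty if there is none.
\<close>

lemma (in lattice) principal_or_whole_generated:
  assumes "principal_or_whole L U"
  obtains M where "finite M" "M \<subseteq> carrier L"
    "\<And>a. a \<in> carrier L \<Longrightarrow> U \<subseteq> down L a \<longleftrightarrow> (\<exists>u\<in>M. u \<sqsubseteq> a)"
proof (cases "\<exists>u\<in>carrier L. U = down L u")
  case True
  then obtain u where u: "u \<in> carrier L" "U = down L u" by blast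
  then have "U \<subseteq> down L a \<longleftrightarrow> (\<exists>v\<in>{u}. v \<sqsubseteq> a)" if "a \<in> carrier L" for a
    using that by (auto simp: down_def intro: le_trans)
  with u(1) show ?thesis by (intro that[of "{u}"]) auto
next
  case False
  with assms have U: "U = carrier L" by (simp add: principal_or_whole_def)
  have "U \<subseteq> down L a \<longleftrightarrow> (\<exists>v\<in>{}. v \<sqsubseteq> a)" if "a \<in> carrier L" for a
    using False U that by (auto simp: down_def)
  then show ?thesis by (intro that[of "{}"]) auto
qed

text \<open>
  The pairs \<open>(a, b)\<close> whose box contains \<open>T\<close> form an upward closed set with finitely many
  generators.
\<close>

definition box_generated ::
    "('a, 'm) gorder_scheme \<Rightarrow> ('b, 'n) gorder_scheme \<Rightarrow> ('a \<times> 'b) set \<Rightarrow> bool"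
  where "box_generated L1 L2 T \<longleftrightarrow> (\<exists>G. finite G \<and> G \<subseteq> carrier L1 \<times> carrier L2 \<and>
    (\<forall>a\<in>carrier L1. \<forall>b\<in>carrier L2.
      T \<subseteq> box L1 L2 a b \<longleftrightarrow> (\<exists>(c, d)\<in>G. c \<sqsubseteq>\<^bsub>L1\<^esub> a \<and> d \<sqsubseteq>\<^bsub>L2\<^esub> b)))"

lemma (in weak_upper_semilattice) join_le_iff:
  assumes "x \<in> carrier L" "y \<in> carrier L" "z \<in> carrier L"
  shows "x \<squnion> y \<sqsubseteq> z \<longleftrightarrow> x \<sqsubseteq> z \<and> y \<sqsubseteq> z"
  using assms by (meson join_closed join_le join_left join_right le_trans)

locale two_lattices_with_zero =
  L1: lattice_with_zero L1 + L2: lattice_with_zero L2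
  for L1 :: "('a, 'm) gorder_scheme" and L2 :: "('b, 'n) gorder_scheme"
begin

text \<open>
  The componentwise joins of a generator for \<open>S\<close> with a generator for \<open>T\<close> generate the pairs
  for \<open>S \<union> T\<close>.
\<close>

lemma box_generated_Un:
  assumes "box_generated L1 L2 S" "box_generated L1 L2 T"
  shows "box_generated L1 L2 (S \<union> T)"
proof -
  from assms(1) obtain G where G: "finite G" "G \<subseteq> carrier L1 \<times> carrier L2"
    and S: "\<forall>a\<in>carrier L1. \<forall>b\<in>carrier L2.
      S \<subseteq> box L1 L2 a b \<longleftrightarrow> (\<exists>(c, d)\<in>G. c \<sqsubseteq>\<^bsub>L1\<^esub> a \<and> d \<sqsubseteq>\<^bsub>L2\<^esub> b)"
    unfolding box_generated_def by blast
  from assms(2) obtain H where H: "finite H" "H \<subseteq> carrier L1 \<times> carrier L2"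
    and T: "\<forall>a\<in>carrier L1. \<forall>b\<in>carrier L2.
      T \<subseteq> box L1 L2 a b \<longleftrightarrow> (\<exists>(c, d)\<in>H. c \<sqsubseteq>\<^bsub>L1\<^esub> a \<and> d \<sqsubseteq>\<^bsub>L2\<^esub> b)"
    unfolding box_generated_def by blast
  define j where "j = (\<lambda>((c, d), (c', d')). (c \<squnion>\<^bsub>L1\<^esub> c', d \<squnion>\<^bsub>L2\<^esub> d'))"
  have "finite (j ` (G \<times> H))" using G(1) H(1) by simp
  moreover have "j ` (G \<times> H) \<subseteq> carrier L1 \<times> carrier L2"
  proof (rule image_subsetI)
    fix r assume "r \<in> G \<times> H"
    then obtain c d c' d' where r: "r = ((c, d), (c', d'))" "(c, d) \<in> G" "(c', d') \<in> H" by auto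
    then have "c \<in> carrier L1" "d \<in> carrier L2" "c' \<in> carrier L1" "d' \<in> carrier L2"
      using G(2) H(2) by blast+
    then show "j r \<in> carrier L1 \<times> carrier L2" by (simp add: r(1) j_def)
  qed
  moreover have "S \<union> T \<subseteq> box L1 L2 a b \<longleftrightarrow>
      (\<exists>(c, d)\<in>j ` (G \<times> H). c \<sqsubseteq>\<^bsub>L1\<^esub> a \<and> d \<sqsubseteq>\<^bsub>L2\<^esub> b)"
    if ab: "a \<in> carrier L1" "b \<in> carrier L2" for a b
  proof -
    define below where "below = (\<lambda>(c, d). c \<sqsubseteq>\<^bsub>L1\<^esub> a \<and> d \<sqsubseteq>\<^bsub>L2\<^esub> b)"
    have join: "below (j (p, q)) \<longleftrightarrow> below p \<and> below q" if "p \<in> G" "q \<in> H" for p q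
    proof -
      obtain c d c' d' where pq: "p = (c, d)" "q = (c', d')" by (metis surj_pair)
      with that G(2) H(2) have "c \<in> carrier L1" "d \<in> carrier L2" "c' \<in> carrier L1" "d' \<in> carrier L2"
        by blast+
      then show ?thesis
        using ab by (simp add: below_def j_def pq L1.join_le_iff L2.join_le_iff conj_ac)
    qed
    have "(\<exists>r\<in>j ` (G \<times> H). below r) \<longleftrightarrow> (\<exists>p\<in>G. \<exists>q\<in>H. below (j (p, q)))" by auto
    also have "\<dots> \<longleftrightarrow> (\<exists>p\<in>G. below p) \<and> (\<exists>q\<in>H. below q)"
      using join by blast
    also have "\<dots> \<longleftrightarrow> S \<subseteq> box L1 L2 a b \<and> T \<subseteq> box L1 L2 a b"
      using S T ab by (simp add: below_def)
    finally show ?thesis by (simp add: below_def)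
  qed
  ultimately show ?thesis
    unfolding box_generated_def by (intro exI[of _ "j ` (G \<times> H)"] conjI ballI)
qed

text \<open>
  The complement of a box is a rectangle, so that a box contains \<open>U \<times> V\<close> only if its first
  component bounds \<open>U\<close> or its second component bounds \<open>V\<close>. The component without a condition is
  generated by zero.
\<close>

lemma box_generated_Times:
  assumes "principal_or_whole L1 U" "principal_or_whole L2 V"
  shows "box_generated L1 L2 (U \<times> V)"
proof -
  obtain M where M: "finite M" "M \<subseteq> carrier L1"
      "\<And>a. a \<in> carrier L1 \<Longrightarrow> U \<subseteq> down L1 a \<longleftrightarrow> (\<exists>u\<in>M. u \<sqsubseteq>\<^bsub>L1\<^esub> a)"
    using L1.principal_or_whole_generated[OF assms(1)] by blast
  obtain N where N: "finite N" "N \<subseteq> carrier L2"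
      "\<And>b. b \<in> carrier L2 \<Longrightarrow> V \<subseteq> down L2 b \<longleftrightarrow> (\<exists>v\<in>N. v \<sqsubseteq>\<^bsub>L2\<^esub> b)"
    using L2.principal_or_whole_generated[OF assms(2)] by blast
  let ?G = "M \<times> {\<bottom>\<^bsub>L2\<^esub>} \<union> {\<bottom>\<^bsub>L1\<^esub>} \<times> N"
  have UV: "U \<subseteq> carrier L1" "V \<subseteq> carrier L2"
    using assms by (auto simp: principal_or_whole_def down_def)
  have "U \<times> V \<subseteq> box L1 L2 a b \<longleftrightarrow> (\<exists>(c, d)\<in>?G. c \<sqsubseteq>\<^bsub>L1\<^esub> a \<and> d \<sqsubseteq>\<^bsub>L2\<^esub> b)"
    if ab: "a \<in> carrier L1" "b \<in> carrier L2" for a b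
  proof -
    have "U \<times> V \<subseteq> box L1 L2 a b \<longleftrightarrow> U \<subseteq> down L1 a \<or> V \<subseteq> down L2 b"
      using UV unfolding box_def by blast
    also have "\<dots> \<longleftrightarrow> (\<exists>(c, d)\<in>?G. c \<sqsubseteq>\<^bsub>L1\<^esub> a \<and> d \<sqsubseteq>\<^bsub>L2\<^esub> b)"
      using ab M(3) N(3) L1.bottom_lower L2.bottom_lower by auto
    finally show ?thesis .
  qed
  moreover have "finite ?G" "?G \<subseteq> carrier L1 \<times> carrier L2"
    using M(1,2) N(1,2) L1.bottom_closed L2.bottom_closed by auto
  ultimately show ?thesis unfolding box_generated_def by blast
qed

abbreviation boxes :: "('a \<times> 'b) set set"
  where "boxes \<equiv> {box L1 L2 a b |a b. a \<in> carrier L1 \<and> b \<in> carrier L2}"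

text \<open>
  Intersecting a rectangle with a box splits it into two rectangles, one for each half of the box.
  The induction therefore has to be over arbitrary rectangles.
\<close>

lemma box_generated_Times_Inter:
  assumes "finite F" "F \<subseteq> boxes" "principal_or_whole L1 U" "principal_or_whole L2 V"
  shows "box_generated L1 L2 (U \<times> V \<inter> \<Inter>F)"
  using assms
proof (induction F arbitrary: U V rule: finite_induct)
  case empty
  then show ?case by (simp add: box_generated_Times)
next
  case (insert B F)
  then obtain a b where ab: "a \<in> carrier L1" "b \<in> carrier L2" "B = box L1 L2 a b" by auto
  have UV: "U \<subseteq> carrier L1" "V \<subseteq> carrier L2"
    using insert.prems by (auto simp: principal_or_whole_def down_def)
  have split: "U \<times> V \<inter> \<Inter>(insert B F) =
      ((U \<inter> down L1 a) \<times> V \<inter> \<Inter>F) \<union> (U \<times> (V \<inter> down L2 b) \<inter> \<Inter>F)"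
    using UV unfolding ab(3) box_def Inter_insert by blast
  have "F \<subseteq> boxes" using insert.prems(1) by blast
  have "box_generated L1 L2 ((U \<inter> down L1 a) \<times> V \<inter> \<Inter>F)"
    by (rule insert.IH[OF \<open>F \<subseteq> boxes\<close>
          L1.principal_or_whole_Int_down[OF insert.prems(2) ab(1)] insert.prems(3)])
  moreover have "box_generated L1 L2 (U \<times> (V \<inter> down L2 b) \<inter> \<Inter>F)"
    by (rule insert.IH[OF \<open>F \<subseteq> boxes\<close> insert.prems(2)
          L2.principal_or_whole_Int_down[OF insert.prems(3) ab(2)]])
  ultimately have "box_generated L1 L2
      (((U \<inter> down L1 a) \<times> V \<inter> \<Inter>F) \<union> (U \<times> (V \<inter> down L2 b) \<inter> \<Inter>F))"
    by (rule box_generated_Un)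
  then show ?case unfolding split .
qed

lemma box_generated_Inter:
  assumes "A \<in> finite_Inters boxes"
  shows "box_generated L1 L2 A"
proof -
  from assms obtain F where F: "finite F" "F \<noteq> {}" "F \<subseteq> boxes" "A = \<Inter>F"
    unfolding finite_Inters_def by blast
  have "B \<subseteq> carrier L1 \<times> carrier L2" if "B \<in> F" for B
    using that F(3) by (auto simp: box_def down_def)
  then have "A = carrier L1 \<times> carrier L2 \<inter> \<Inter>F" using F(2,4) by blast
  then show ?thesis
    using box_generated_Times_Inter[OF F(1,3)] by (simp add: principal_or_whole_def)
qed

lemma box_mono:
  assumes "c \<sqsubseteq>\<^bsub>L1\<^esub> a" "d \<sqsubseteq>\<^bsub>L2\<^esub> b" "a \<in> carrier L1" "b \<in> carrier L2" "c \<in> carrier L1" "d \<in> carrier L2"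
  shows "box L1 L2 c d \<subseteq> box L1 L2 a b"
  using assms unfolding box_def down_def by (auto intro: L1.le_trans L2.le_trans)

lemma lattice_box_product: "lattice (box_product L1 L2)"
  unfolding box_product_def
proof (rule lattice_finite_Inters)
  fix A A' assume A: "A \<in> finite_Inters boxes" "A' \<in> finite_Inters boxes"
  then have "box_generated L1 L2 (A \<union> A')"
    by (intro box_generated_Un box_generated_Inter)
  then obtain G where G: "finite G" "G \<subseteq> carrier L1 \<times> carrier L2"
    and "\<forall>a\<in>carrier L1. \<forall>b\<in>carrier L2.
      A \<union> A' \<subseteq> box L1 L2 a b \<longleftrightarrow> (\<exists>(c, d)\<in>G. c \<sqsubseteq>\<^bsub>L1\<^esub> a \<and> d \<sqsubseteq>\<^bsub>L2\<^esub> b)"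
    unfolding box_generated_def by blast
  then have iff: "A \<union> A' \<subseteq> box L1 L2 a b \<longleftrightarrow> (\<exists>(c, d)\<in>G. c \<sqsubseteq>\<^bsub>L1\<^esub> a \<and> d \<sqsubseteq>\<^bsub>L2\<^esub> b)"
    if "a \<in> carrier L1" "b \<in> carrier L2" for a b using that by simp
  let ?F = "(\<lambda>(c, d). box L1 L2 c d) ` G"
  \<comment> \<open>Some box contains both elements: join a box containing \<open>A\<close> and one containing \<open>A'\<close> componentwise.\<close>
  have "G \<noteq> {}"
  proof -
    have ex: "\<exists>a\<in>carrier L1. \<exists>b\<in>carrier L2. S \<subseteq> box L1 L2 a b" if "S \<in> finite_Inters boxes" for S
    proof -
      from that obtain F where "F \<noteq> {}" "F \<subseteq> boxes" "S = \<Inter>F"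
        unfolding finite_Inters_def by blast
      then obtain B where "B \<in> boxes" "S \<subseteq> B" by blast
      then show ?thesis by blast
    qed
    from ex[OF A(1)] ex[OF A(2)] obtain a b a' b'
      where ab: "a \<in> carrier L1" "b \<in> carrier L2" "a' \<in> carrier L1" "b' \<in> carrier L2"
        and sub: "A \<subseteq> box L1 L2 a b" "A' \<subseteq> box L1 L2 a' b'" by blast
    let ?a = "a \<squnion>\<^bsub>L1\<^esub> a'" and ?b = "b \<squnion>\<^bsub>L2\<^esub> b'"
    have "box L1 L2 a b \<subseteq> box L1 L2 ?a ?b" "box L1 L2 a' b' \<subseteq> box L1 L2 ?a ?b"
      using ab by (simp_all add: box_mono L1.join_left L1.join_right L2.join_left L2.join_right)
    with sub have "A \<union> A' \<subseteq> box L1 L2 ?a ?b" by blast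
    moreover have "?a \<in> carrier L1" "?b \<in> carrier L2" using ab by simp_all
    ultimately show ?thesis using iff[of ?a ?b] by fastforce
  qed
  moreover have "A \<union> A' \<subseteq> C" if C: "C \<in> ?F" for C
  proof -
    from C obtain c d where cd: "(c, d) \<in> G" "C = box L1 L2 c d" by auto
    with G(2) have "c \<in> carrier L1" "d \<in> carrier L2" by blast+
    moreover from this have "c \<sqsubseteq>\<^bsub>L1\<^esub> c" "d \<sqsubseteq>\<^bsub>L2\<^esub> d" by simp_all
    ultimately show ?thesis using iff[of c d] cd by blast
  qed
  moreover have "\<exists>D\<in>?F. D \<subseteq> C" if C: "C \<in> boxes" "A \<union> A' \<subseteq> C" for C
  proof -
    from C obtain a b where ab: "a \<in> carrier L1" "b \<in> carrier L2" "C = box L1 L2 a b" by blast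
    with C(2) iff[of a b] obtain c d where cd: "(c, d) \<in> G" "c \<sqsubseteq>\<^bsub>L1\<^esub> a" "d \<sqsubseteq>\<^bsub>L2\<^esub> b" by blast
    with G(2) have "c \<in> carrier L1" "d \<in> carrier L2" by blast+
    with ab cd have "box L1 L2 c d \<subseteq> C" by (simp add: box_mono)
    moreover have "box L1 L2 c d \<in> ?F" using cd(1) by force
    ultimately show ?thesis ..
  qed
  moreover have "?F \<subseteq> boxes"
  proof (rule image_subsetI)
    fix p assume "p \<in> G"
    with G(2) obtain c d where "p = (c, d)" "c \<in> carrier L1" "d \<in> carrier L2" by blast
    then show "(case p of (c, d) \<Rightarrow> box L1 L2 c d) \<in> boxes" by auto
  qed
  moreover have "finite ?F" using G(1) by simp
  ultimately show "\<exists>F. finite F \<and> F \<noteq> {} \<and> F \<subseteq> boxes \<and> (\<forall>C\<in>F. A \<union> A' \<subseteq> C) \<and>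
      (\<forall>C\<in>boxes. A \<union> A' \<subseteq> C \<longrightarrow> (\<exists>D\<in>F. D \<subseteq> C))"
    by (intro exI[of _ ?F] conjI ballI impI) (simp_all only: image_is_empty not_False_eq_True)
qed

end

section \<open>Passing from pairs of atoms to pairs of elements\<close>

lemma (in atomistic_lattice) le_iff_atoms_below_subset:
  assumes x: "x \<in> carrier L" and a: "a \<in> carrier L"
  shows "x \<sqsubseteq> a \<longleftrightarrow> atoms_below L x \<subseteq> atoms_below L a"
proof
  assume "x \<sqsubseteq> a"
  then show "atoms_below L x \<subseteq> atoms_below L a"
    using x a by (auto simp: atoms_below_def atoms_def intro: le_trans)
next
  assume "atoms_below L x \<subseteq> atoms_below L a"
  then have "a \<in> Upper L (atoms_below L x)"
    using a by (auto simp: Upper_def atoms_below_def)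
  with is_lub_atoms_below[OF x] show "x \<sqsubseteq> a" by (rule least_le)
qed

lemma (in weak_partial_order) atoms_below_atom:
  assumes "p \<in> atoms L"
  shows "atoms_below L p = {p}"
  using assms by (auto simp: atoms_below_def atoms_def)

definition saturate ::
    "('a, 'm) gorder_scheme \<Rightarrow> ('b, 'n) gorder_scheme \<Rightarrow> ('a \<times> 'b) set \<Rightarrow> ('a \<times> 'b) set"
  where "saturate L1 L2 H =
    {(x, y) \<in> carrier L1 \<times> carrier L2. atoms_below L1 x \<times> atoms_below L2 y \<subseteq> H}"

text \<open>
  The family must be nonempty: the empty intersection is the set of all pairs of the two types,
  whereas a saturated set lies in the product of the carriers.
\<close>

lemma saturate_Inter:
  assumes "F \<noteq> {}"
  shows "saturate L1 L2 (\<Inter>F) = \<Inter>(saturate L1 L2 ` F)"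
  using assms unfolding saturate_def by blast

lemma finite_Inters_image:
  assumes "\<And>F. F \<noteq> {} \<Longrightarrow> f (\<Inter>F) = \<Inter>(f ` F)"
  shows "f ` finite_Inters B = finite_Inters (f ` B)"
proof
  show "f ` finite_Inters B \<subseteq> finite_Inters (f ` B)"
  proof
    fix A assume "A \<in> f ` finite_Inters B"
    then obtain F where "finite F" "F \<noteq> {}" "F \<subseteq> B" "A = f (\<Inter>F)"
      unfolding finite_Inters_def by blast
    then have "finite (f ` F)" "f ` F \<noteq> {}" "f ` F \<subseteq> f ` B" "A = \<Inter>(f ` F)"
      using assms by auto
    then show "A \<in> finite_Inters (f ` B)" unfolding finite_Inters_def by blast
  qed
  show "finite_Inters (f ` B) \<subseteq> f ` finite_Inters B"
  proof
    fix A assume "A \<in> finite_Inters (f ` B)"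
    then obtain G where G: "finite G" "G \<noteq> {}" "G \<subseteq> f ` B" "A = \<Inter>G"
      unfolding finite_Inters_def by blast
    obtain F where F: "F \<subseteq> B" "finite F" "G = f ` F"
      using finite_subset_image[OF G(1,3)] by blast
    then have "F \<noteq> {}" "A = f (\<Inter>F)" using G assms by auto
    with F show "A \<in> f ` finite_Inters B" unfolding finite_Inters_def by blast
  qed
qed

locale two_atomistic_lattices =
  L1: atomistic_lattice L1 + L2: atomistic_lattice L2
  for L1 :: "('a, 'm) gorder_scheme" and L2 :: "('b, 'n) gorder_scheme"
begin

sublocale two_lattices_with_zero L1 L2
  by unfold_locales

text \<open>
  A product of two sets of atoms lies in an atom box only if one factor lies in the corresponding
  set \<open>atoms_below\<close>, and by atomisticity this means that \<open>x\<close> is below \<open>a\<close> or \<open>y\<close> is below \<open>b\<close>.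
\<close>

lemma saturate_atom_box:
  assumes "a \<in> carrier L1" "b \<in> carrier L2"
  shows "saturate L1 L2 (atom_box L1 L2 a b) = box L1 L2 a b"
proof -
  have "atoms_below L1 x \<times> atoms_below L2 y \<subseteq> atom_box L1 L2 a b \<longleftrightarrow> x \<sqsubseteq>\<^bsub>L1\<^esub> a \<or> y \<sqsubseteq>\<^bsub>L2\<^esub> b"
    if "x \<in> carrier L1" "y \<in> carrier L2" for x y
  proof -
    have "atoms_below L1 x \<subseteq> atoms L1" "atoms_below L2 y \<subseteq> atoms L2"
      by (auto simp: atoms_below_def)
    then have "atoms_below L1 x \<times> atoms_below L2 y \<subseteq> atom_box L1 L2 a b \<longleftrightarrow>
        atoms_below L1 x \<subseteq> atoms_below L1 a \<or> atoms_below L2 y \<subseteq> atoms_below L2 b"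
      unfolding atom_box_def by blast
    then show ?thesis
      using that assms by (simp add: L1.le_iff_atoms_below_subset L2.le_iff_atoms_below_subset)
  qed
  then show ?thesis by (auto simp: saturate_def box_def down_def)
qed

text \<open>The only atom below an atom is that atom itself, so that saturating adds no pair of atoms.\<close>

lemma saturate_Int_atoms:
  assumes "H \<subseteq> atoms L1 \<times> atoms L2"
  shows "saturate L1 L2 H \<inter> atoms L1 \<times> atoms L2 = H"
proof -
  have "(p, q) \<in> saturate L1 L2 H \<longleftrightarrow> (p, q) \<in> H" if "p \<in> atoms L1" "q \<in> atoms L2" for p q
  proof -
    have "p \<in> carrier L1" "q \<in> carrier L2" using that by (simp_all add: atoms_def)
    then show ?thesis
      using that by (simp add: saturate_def L1.atoms_below_atom L2.atoms_below_atom)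
  qed
  then show ?thesis using assms by auto
qed

lemma saturate_subset_iff:
  assumes "H \<subseteq> atoms L1 \<times> atoms L2" "K \<subseteq> atoms L1 \<times> atoms L2"
  shows "saturate L1 L2 H \<subseteq> saturate L1 L2 K \<longleftrightarrow> H \<subseteq> K"
proof
  assume "saturate L1 L2 H \<subseteq> saturate L1 L2 K"
  then show "H \<subseteq> K"
    using saturate_Int_atoms[OF assms(1)] saturate_Int_atoms[OF assms(2)] by blast
next
  assume "H \<subseteq> K"
  then show "saturate L1 L2 H \<subseteq> saturate L1 L2 K" by (auto simp: saturate_def)
qed

lemma carrier_tensor_n_subset:
  assumes "H \<in> carrier (tensor_n L1 L2)"
  shows "H \<subseteq> atoms L1 \<times> atoms L2"
proof -
  from assms obtain F where "F \<noteq> {}" "H = \<Inter>F"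
    "F \<subseteq> {atom_box L1 L2 a b |a b. a \<in> carrier L1 \<and> b \<in> carrier L2}"
    by (auto simp: tensor_n_def inclusion_order_def finite_Inters_def)
  then obtain a b where "H \<subseteq> atom_box L1 L2 a b" by blast
  also have "\<dots> \<subseteq> atoms L1 \<times> atoms L2" by (auto simp: atom_box_def atoms_below_def)
  finally show ?thesis .
qed

lemma bij_betw_saturate:
  "bij_betw (saturate L1 L2) (carrier (tensor_n L1 L2)) (carrier (box_product L1 L2))"
  unfolding bij_betw_def
proof
  show "inj_on (saturate L1 L2) (carrier (tensor_n L1 L2))"
    by (rule inj_onI) (metis saturate_Int_atoms carrier_tensor_n_subset)
  let ?atom_boxes = "{atom_box L1 L2 a b |a b. a \<in> carrier L1 \<and> b \<in> carrier L2}"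
  have "saturate L1 L2 ` ?atom_boxes = boxes"
  proof (intro equalityI subsetI)
    fix B assume "B \<in> boxes"
    then obtain a b where "a \<in> carrier L1" "b \<in> carrier L2" "B = box L1 L2 a b" by blast
    then show "B \<in> saturate L1 L2 ` ?atom_boxes"
      by (intro image_eqI[of _ _ "atom_box L1 L2 a b"]) (auto simp: saturate_atom_box)
  next
    fix B assume "B \<in> saturate L1 L2 ` ?atom_boxes"
    then obtain a b where "a \<in> carrier L1" "b \<in> carrier L2"
      "B = saturate L1 L2 (atom_box L1 L2 a b)" by blast
    then show "B \<in> boxes" using saturate_atom_box[of a b] by blast
  qed
  then show "saturate L1 L2 ` carrier (tensor_n L1 L2) = carrier (box_product L1 L2)"
    by (simp add: tensor_n_def box_product_def inclusion_order_def finite_Inters_image saturate_Inter)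
qed

lemma order_emb_saturate: "order_emb (tensor_n L1 L2) (box_product L1 L2) (saturate L1 L2)"
proof -
  have le: "(\<sqsubseteq>\<^bsub>tensor_n L1 L2\<^esub>) = (\<subseteq>)" "(\<sqsubseteq>\<^bsub>box_product L1 L2\<^esub>) = (\<subseteq>)"
    by (simp_all add: tensor_n_def box_product_def inclusion_order_def)
  have "weak_partial_order (tensor_n L1 L2)" "weak_partial_order (box_product L1 L2)"
    unfolding tensor_n_def box_product_def
    by (rule partial_order.axioms(1)[OF partial_order_inclusion_order])+
  then show ?thesis
    by (simp add: order_emb_def le saturate_subset_iff carrier_tensor_n_subset)
qed

end

theorem theorem3p11:
  fixes L1 :: "('a, 'm) gorder_scheme" and L2 :: "('b, 'n) gorder_scheme"
  assumes "atomistic_lattice L1" and "atomistic_lattice L2"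
  shows "lattice_isomorphic (tensor_n L1 L2) (box_product L1 L2)"
proof -
  interpret two_atomistic_lattices L1 L2
    using assms by (simp add: two_atomistic_lattices_def)
  have "partial_order (tensor_n L1 L2)"
    unfolding tensor_n_def by (rule partial_order_inclusion_order)
  then show ?thesis
    using lattice_box_product order_emb_saturate bij_betw_saturate
    by (rule lattice_isomorphic_if_order_iso)
qed

end
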